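(* The function $$\mathcal{B}(x,y)=\frac1\pi(1-2\bar x\bar y+\bar x^2\bar y^2)(1-2{\rm Re}(x)\bar y+|x|^2\bar y^2)^{-2}$$ is a reproducing kernel for the octonionic slice Bergman space $\mathcal{A}(B_8(0,1))$ of the unit ball.
   Context: $\mathbb{O}\cong\mathbb{R}^8$ denotes the (non-associative) octonions with conjugation $x\mapsto\bar{x}$, real part ${\rm Re}(x)$ and norm $|x|=\sqrt{x\bar{x}}$; $B_8(0,1)=\{x\in\mathbb{O}:|x|<1\}$. $\mathbb{S}$ is the sphere of purely imaginary unit octonions and $\mathbb{C}_I=\mathbb{R}+\mathbb{R}I$ for $I\in\mathbb{S}$. A real differentiable $f:B_8(0,1)\to\mathbb{O}$ is slice monogenic if for every $I\in\mathbb{S}$ its restriction $f_I$ to $B_8(0,1)\cap\mathbb{C}_I$ satisfies $\frac12(\frac{\partial}{\partial u}+I\frac{\partial}{\partial v})f_I(u+Iv)=0$. $\mathcal{A}(B_8(0,1))$ is the set of slice monogenic $f$ on $B_8(0,1)$ such that $\int_{B_8(0,1)\cap\mathbb{C}_I}|f_I|^2\,du\,dv<\infty$ for some $I\in\mathbb{S}$ (equivalently for all $I$). For $I\in\mathbb{S}$ set $\langle f,g\rangle_I=\int_{B_8(0,1)\cap\mathbb{C}_I}\overline{g(y)}f(y)\,du\,dv$, $y=u+Iv$. "Reproducing kernel" means that for every $f\in\mathcal{A}(B_8(0,1))$, every $I\in\mathbb{S}$ and every $x\in B_8(0,1)\cap\mathbb{C}_I$ one has $\langle f,\mathcal{B}(\cdot,x)\rangle_I=\int_{B_8(0,1)\cap\mathbb{C}_I}\overline{\mathcal{B}(y,x)}\,f(y)\,du\,dv=f(x)$;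 the values of $f$ off $\mathbb{C}_I$ are then determined by those on $\mathbb{C}_I$ through the Representation Formula $f(u+Jv)=\frac12[f(u+Iv)+f(u-Iv)]+\frac12J[I(f(u-Iv)-f(u+Iv))]$, $J\in\mathbb{S}$. *)

theory Defs
  imports "HOL-Analysis.Analysis"
begin

codatatype octonion = Octonion
  (Ree: real) (Im1: real) (Im2: real) (Im3: real) (Im4: real) (Im5: real) (Im6: real) (Im7: real)

lemma octonion_eqI [intro?]:
  "\<lbrakk>Ree x = Ree y; Im1 x = Im1 y; Im2 x = Im2 y; Im3 x = Im3 y; Im4 x = Im4 y;
     Im5 x = Im5 y; Im6 x = Im6 y; Im7 x = Im7 y\<rbrakk> \<Longrightarrow> x = y"
  by (rule octonion.expand) simp

lemma octonion_eq_iff: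
  "x = y \<longleftrightarrow> Ree x = Ree y \<and> Im1 x = Im1 y \<and> Im2 x = Im2 y \<and>
     Im3 x = Im3 y \<and> Im4 x = Im4 y \<and> Im5 x = Im5 y \<and> Im6 x = Im6 y \<and>
     Im7 x = Im7 y"
  by (auto intro: octonion_eqI)

instantiation octonion :: ab_group_add
begin

primcorec zero_octonion where
  "Ree (0) = 0"
| "Im1 (0) = 0"
| "Im2 (0) = 0"
| "Im3 (0) = 0"
| "Im4 (0) = 0"
| "Im5 (0) = 0"
| "Im6 (0) = 0"
| "Im7 (0) = 0"

primcorec plus_octonion where
  "Ree (x + y) = Ree x + Ree y"
| "Im1 (x + y) = Im1 x + Im1 y"
| "Im2 (x + y) = Im2 x + Im2 y"
| "Im3 (x + y) = Im3 x + Im3 y"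
| "Im4 (x + y) = Im4 x + Im4 y"
| "Im5 (x + y) = Im5 x + Im5 y"
| "Im6 (x + y) = Im6 x + Im6 y"
| "Im7 (x + y) = Im7 x + Im7 y"

primcorec uminus_octonion where
  "Ree (- x) = - Ree x"
| "Im1 (- x) = - Im1 x"
| "Im2 (- x) = - Im2 x"
| "Im3 (- x) = - Im3 x"
| "Im4 (- x) = - Im4 x"
| "Im5 (- x) = - Im5 x"
| "Im6 (- x) = - Im6 x"
| "Im7 (- x) = - Im7 x"

primcorec minus_octonion where
  "Ree (x - y) = Ree x - Ree y"
| "Im1 (x - y) = Im1 x - Im1 y"
| "Im2 (x - y) = Im2 x - Im2 y"
| "Im3 (x - y) = Im3 x - Im3 y"
| "Im4 (x - y) = Im4 x - Im4 y"
| "Im5 (x - y) = Im5 x - Im5 y"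
| "Im6 (x - y) = Im6 x - Im6 y"
| "Im7 (x - y) = Im7 x - Im7 y"

instance
  by standard (simp_all add: octonion_eq_iff)

end

instantiation octonion :: real_vector
begin

primcorec scaleR_octonion where
  "Ree (scaleR r x) = r * Ree x"
| "Im1 (scaleR r x) = r * Im1 x"
| "Im2 (scaleR r x) = r * Im2 x"
| "Im3 (scaleR r x) = r * Im3 x"
| "Im4 (scaleR r x) = r * Im4 x"
| "Im5 (scaleR r x) = r * Im5 x"
| "Im6 (scaleR r x) = r * Im6 x"
| "Im7 (scaleR r x) = r * Im7 x"

instance
  by standard (simp_all add: octonion_eq_iff algebra_simps)

end

instantiation octonion :: real_inner
begin

definition inner_octonion :: "octonion \<Rightarrow> octonion \<Rightarrow> real" where
  "inner_octonion x y = Ree x * Ree y + Im1 x * Im1 y + Im2 x * Im2 y + Im3 x * Im3 y +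
     Im4 x * Im4 y + Im5 x * Im5 y + Im6 x * Im6 y + Im7 x * Im7 y"

definition norm_octonion :: "octonion \<Rightarrow> real" where
  "norm_octonion x = sqrt (inner x x)"

definition sgn_octonion :: "octonion \<Rightarrow> octonion" where
  "sgn_octonion x = x /\<^sub>R norm x"

definition dist_octonion :: "octonion \<Rightarrow> octonion \<Rightarrow> real" where
  "dist_octonion x y = norm (x - y)"

definition uniformity_octonion :: "(octonion \<times> octonion) filter" where
  "uniformity_octonion = (INF e\<in>{0 <..}. principal {(x, y). dist x y < e})"

definition open_octonion :: "octonion set \<Rightarrow> bool" where
  "open_octonion U \<longleftrightarrow> (\<forall>x\<in>U. eventually (\<lambda>(x', y). x' = x \<longrightarrow> y \<in> U) uniformity)"

instance
proof
  fix x y z :: octonion and r :: real and U :: "octonion set"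
  show "dist x y = norm (x - y)" by (rule dist_octonion_def)
  show "sgn x = x /\<^sub>R norm x" by (rule sgn_octonion_def)
  show "uniformity = (INF e\<in>{0 <..}. principal {(x :: octonion, y). dist x y < e})"
    by (rule uniformity_octonion_def)
  show "open U \<longleftrightarrow> (\<forall>x\<in>U. eventually (\<lambda>(x', y). x' = x \<longrightarrow> y \<in> U) uniformity)"
    by (rule open_octonion_def)
  show "inner x y = inner y x" by (simp add: inner_octonion_def mult.commute)
  show "inner (x + y) z = inner x z + inner y z"
    by (simp add: inner_octonion_def algebra_simps)
  show "inner (r *\<^sub>R x) y = r * inner x y"
    by (simp add: inner_octonion_def algebra_simps)
  show "0 \<le> inner x x" by (simp add: inner_octonion_def)
  show "inner x x = 0 \<longleftrightarrow> x = 0"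
    by (simp add: inner_octonion_def octonion_eq_iff add_nonneg_eq_0_iff)
  show "norm x = sqrt (inner x x)" by (rule norm_octonion_def)
qed

end

instantiation octonion :: euclidean_space
begin

definition Basis_octonion :: "octonion set" where
  "Basis_octonion = {
    Octonion 1 0 0 0 0 0 0 0,
    Octonion 0 1 0 0 0 0 0 0,
    Octonion 0 0 1 0 0 0 0 0,
    Octonion 0 0 0 1 0 0 0 0,
    Octonion 0 0 0 0 1 0 0 0,
    Octonion 0 0 0 0 0 1 0 0,
    Octonion 0 0 0 0 0 0 1 0,
    Octonion 0 0 0 0 0 0 0 1}"

instance
proof
  show "(Basis :: octonion set) \<noteq> {}" "finite (Basis :: octonion set)"
    by (simp_all add: Basis_octonion_def)
next
  fix u v :: octonion
  assume "u \<in> Basis" "v \<in> Basis"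
  then show "inner u v = (if u = v then 1 else 0)"
    unfolding Basis_octonion_def
    by (elim insertE emptyE; hypsubst; simp add: inner_octonion_def)
next
  fix x :: octonion
  show "(\<forall>u\<in>Basis. inner x u = 0) \<longleftrightarrow> x = 0"
    by (simp add: Basis_octonion_def inner_octonion_def) (simp add: octonion_eq_iff)
qed

end

lemma DIM_octonion: "DIM(octonion) = 8"
  by (simp add: Basis_octonion_def)

primcorec octo_cnj :: "octonion \<Rightarrow> octonion" where
  "Ree (octo_cnj x) = Ree x"
| "Im1 (octo_cnj x) = - Im1 x"
| "Im2 (octo_cnj x) = - Im2 x"
| "Im3 (octo_cnj x) = - Im3 x"
| "Im4 (octo_cnj x) = - Im4 x"
| "Im5 (octo_cnj x) = - Im5 x"
| "Im6 (octo_cnj x) = - Im6 x"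
| "Im7 (octo_cnj x) = - Im7 x"

text \<open>
  With \<open>e\<^sub>0 = 1\<close> and \<open>e\<^sub>i\<close> the unit in component \<open>Im\<close>\<open>i\<close>, the product is given by \<open>e\<^sub>i\<^sup>2 = -1\<close>, \<open>e\<^sub>i e\<^sub>j = - e\<^sub>j e\<^sub>i\<close> for \<open>i \<noteq> j\<close>, and
  \<open>e\<^sub>a e\<^sub>b = e\<^sub>c\<close>, cyclically in \<open>(a, b, c)\<close>, for the seven triples
  \<open>(a, b, c) = (i, i + 1, i + 3)\<close> with indices in \<open>{1, ..., 7}\<close> taken modulo 7.
  As the product is not associative, only the bare operations are overloaded: none of
  the ring classes apply, and \<open>of_real\<close> is not available (the real number \<open>r\<close> is
  \<open>r *\<^sub>R 1\<close>).
\<close>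

instantiation octonion :: "{one, times, inverse}"
begin

primcorec one_octonion where
  "Ree (1) = 1"
| "Im1 (1) = 0"
| "Im2 (1) = 0"
| "Im3 (1) = 0"
| "Im4 (1) = 0"
| "Im5 (1) = 0"
| "Im6 (1) = 0"
| "Im7 (1) = 0"

primcorec times_octonion where
  "Ree (x * y) = Ree x * Ree y - Im1 x * Im1 y - Im2 x * Im2 y - Im3 x * Im3 y
      - Im4 x * Im4 y - Im5 x * Im5 y - Im6 x * Im6 y - Im7 x * Im7 y"
| "Im1 (x * y) = Ree x * Im1 y + Im1 x * Ree y
      + Im2 x * Im4 y - Im4 x * Im2 y
      + Im5 x * Im6 y - Im6 x * Im5 y
      + Im3 x * Im7 y - Im7 x * Im3 y"
| "Im2 (x * y) = Ree x * Im2 y + Im2 x * Ree y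
      + Im4 x * Im1 y - Im1 x * Im4 y
      + Im3 x * Im5 y - Im5 x * Im3 y
      + Im6 x * Im7 y - Im7 x * Im6 y"
| "Im3 (x * y) = Ree x * Im3 y + Im3 x * Ree y
      + Im5 x * Im2 y - Im2 x * Im5 y
      + Im4 x * Im6 y - Im6 x * Im4 y
      + Im7 x * Im1 y - Im1 x * Im7 y"
| "Im4 (x * y) = Ree x * Im4 y + Im4 x * Ree y
      + Im1 x * Im2 y - Im2 x * Im1 y
      + Im6 x * Im3 y - Im3 x * Im6 y
      + Im5 x * Im7 y - Im7 x * Im5 y"
| "Im5 (x * y) = Ree x * Im5 y + Im5 x * Ree y
      + Im2 x * Im3 y - Im3 x * Im2 y
      + Im7 x * Im4 y - Im4 x * Im7 y
      + Im6 x * Im1 y - Im1 x * Im6 y"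
| "Im6 (x * y) = Ree x * Im6 y + Im6 x * Ree y
      + Im3 x * Im4 y - Im4 x * Im3 y
      + Im1 x * Im5 y - Im5 x * Im1 y
      + Im7 x * Im2 y - Im2 x * Im7 y"
| "Im7 (x * y) = Ree x * Im7 y + Im7 x * Ree y
      + Im4 x * Im5 y - Im5 x * Im4 y
      + Im2 x * Im6 y - Im6 x * Im2 y
      + Im1 x * Im3 y - Im3 x * Im1 y"

definition inverse_octonion :: "octonion \<Rightarrow> octonion" where
  "inverse_octonion x = octo_cnj x /\<^sub>R (norm x)\<^sup>2"

definition divide_octonion :: "octonion \<Rightarrow> octonion \<Rightarrow> octonion" where
  "divide_octonion x y = x * inverse y"

instance ..

end

instance octonion :: power ..

lemma octonion_norm_sq:
  "(norm x)\<^sup>2 = (Ree x)\<^sup>2 + (Im1 x)\<^sup>2 +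
     (Im2 x)\<^sup>2 + (Im3 x)\<^sup>2 + (Im4 x)\<^sup>2 + (Im5 x)\<^sup>2 + (Im6 x)\<^sup>2 +
     (Im7 x)\<^sup>2"
  by (simp add: norm_octonion_def inner_octonion_def power2_eq_square)

lemma octonion_mult_cnj: "x * octo_cnj x = (norm x)\<^sup>2 *\<^sub>R 1" "octo_cnj x * x = (norm x)\<^sup>2 *\<^sub>R 1"
  by (simp_all only: octonion_eq_iff scaleR_octonion.simps octonion_norm_sq)
    (simp_all add: power2_eq_square algebra_simps)

lemma octonion_mult_inverse:
  assumes "x \<noteq> (0 :: octonion)"
  shows "x * inverse x = 1" "inverse x * x = 1"
proof -
  have scale: "x * (r *\<^sub>R y) = r *\<^sub>R (x * y)" "(r *\<^sub>R y) * x = r *\<^sub>R (y * x)" for r y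
    by (simp_all add: octonion_eq_iff algebra_simps)
  show "x * inverse x = 1" "inverse x * x = 1"
    using assms by (simp_all add: inverse_octonion_def scale octonion_mult_cnj)
qed

lemma octonion_cnj_mult_mult: "octo_cnj x * (x * y) = (norm x)\<^sup>2 *\<^sub>R y"
  unfolding octonion_eq_iff octonion_norm_sq times_octonion.simps octo_cnj.simps scaleR_octonion.simps
  by (intro conjI; algebra)

lemma octonion_mult_mult_cnj: "(y * x) * octo_cnj x = (norm x)\<^sup>2 *\<^sub>R y"
  unfolding octonion_eq_iff octonion_norm_sq times_octonion.simps octo_cnj.simps scaleR_octonion.simps
  by (intro conjI; algebra)

lemma inner_octonion_mult_left: "inner (x * y) z = inner y (octo_cnj x * z)"
  unfolding inner_octonion_def times_octonion.simps octo_cnj.simps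
  by algebra

lemma octonion_norm_mult: "norm (x * y) = norm x * norm (y :: octonion)"
proof -
  have "(norm (x * y))\<^sup>2 = (norm x * norm y)\<^sup>2"
    by (simp add: power2_norm_eq_inner power_mult_distrib inner_octonion_mult_left
        octonion_cnj_mult_mult)
  then show ?thesis by simp
qed

definition imag_sphere :: "octonion set" where
  "imag_sphere = {I. Ree I = 0 \<and> norm I = 1}"

text \<open>For \<open>I \<in> imag_sphere\<close> this is an isometric parametrization \<open>(u, v) \<mapsto> u + I v\<close>
  of the slice through \<open>I\<close>, so that \<open>du dv\<close> is Lebesgue measure on the pairs \<open>(u, v)\<close>.\<close>

definition slice_point :: "octonion \<Rightarrow> real \<times> real \<Rightarrow> octonion" where
  "slice_point I = (\<lambda>(u, v). u *\<^sub>R 1 + v *\<^sub>R I)"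

definition complex_slice :: "octonion \<Rightarrow> octonion set" where
  "complex_slice I = range (slice_point I)"

definition slice_disc :: "octonion \<Rightarrow> (real \<times> real) set" where
  "slice_disc I = {p. slice_point I p \<in> ball 0 1}"

definition slice_monogenic :: "(octonion \<Rightarrow> octonion) \<Rightarrow> bool" where
  "slice_monogenic f \<longleftrightarrow>
     f differentiable_on ball 0 1 \<and>
     (\<forall>I\<in>imag_sphere. \<forall>(u, v)\<in>slice_disc I.
        (1 / 2) *\<^sub>R (vector_derivative (\<lambda>t. f (slice_point I (t, v))) (at u)
                   + I * vector_derivative (\<lambda>t. f (slice_point I (u, t))) (at v)) = 0)"

definition slice_bergman_space :: "(octonion \<Rightarrow> octonion) set" where
  "slice_bergman_space = {f. slice_monogenic f \<and>
     (\<exists>I\<in>imag_sphere. set_integrable lborel (slice_disc I) (\<lambda>p. (norm (f (slice_point I p)))\<^sup>2))}"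

definition slice_integrand ::
  "octonion \<Rightarrow> (octonion \<Rightarrow> octonion) \<Rightarrow> (octonion \<Rightarrow> octonion) \<Rightarrow> real \<times> real \<Rightarrow> octonion" where
  "slice_integrand I f g p = octo_cnj (g (slice_point I p)) * f (slice_point I p)"

definition slice_inner ::
  "octonion \<Rightarrow> (octonion \<Rightarrow> octonion) \<Rightarrow> (octonion \<Rightarrow> octonion) \<Rightarrow> octonion" where
  "slice_inner I f g = (LINT p:slice_disc I|lborel. slice_integrand I f g p)"

text \<open>The Bochner integral of a non-integrable function is 0 by convention, hence the explicit
  integrability requirement.\<close>

definition reproducing_kernel :: "(octonion \<Rightarrow> octonion \<Rightarrow> octonion) \<Rightarrow> bool" where
  "reproducing_kernel K \<longleftrightarrow>
     (\<forall>f\<in>slice_bergman_space. \<forall>I\<in>imag_sphere. \<forall>x\<in>ball 0 1 \<inter> complex_slice I.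
        set_integrable lborel (slice_disc I) (slice_integrand I f (\<lambda>y. K y x)) \<and>
        slice_inner I f (\<lambda>y. K y x) = f x)"

definition bergman_kernel :: "octonion \<Rightarrow> octonion \<Rightarrow> octonion" where
  "bergman_kernel x y =
     (1 / pi) *\<^sub>R
       ((1 - 2 *\<^sub>R (octo_cnj x * octo_cnj y) + (octo_cnj x)\<^sup>2 * (octo_cnj y)\<^sup>2)
        * (inverse (1 - (2 * Ree x) *\<^sub>R octo_cnj y
                      + (norm x)\<^sup>2 *\<^sub>R (octo_cnj y)\<^sup>2))\<^sup>2)"

end

theory Submission
  imports Defs "HOL-Complex_Analysis.Conformal_Mappings"
begin

text \<open>
  Fix an imaginary unit \<open>I\<close>. Left multiplication by the slice \<open>\<real> + \<real> I\<close> makes the octonions a complex vector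
  space, because the product is associative when the two left factors lie in one slice
  (\<open>slice_of_mult_left\<close>). A slice monogenic function restricted to the slice is holomorphic for this
  structure, so each complex-linear functional turns it into a holomorphic function \<open>g\<close> on the unit disc.
  For two points of the same slice the octonionic kernel is the classical Bergman kernel
  \<open>1 / (\<pi> (1 - w cnj z)\<^sup>2)\<close> of the disc (\<open>bergman_kernel_slice\<close>). The theorem is thus the
  scalar reproducing property, tested against all functionals.

  The scalar property (\<open>disc_Bergman_kernel_reproducing\<close>) holds for integrable holomorphic \<open>g\<close>. By rotation
  invariance of area, the integrand may be replaced by its averages over circles about \<open>0\<close>. On the circle of
  radius \<open>r\<close> one has \<open>cnj u = r\<^sup>2 / u\<close>, and Cauchy's formula shows that the average is the derivative of \<open>u g u\<close> at
  \<open>z r\<^sup>2\<close> (\<open>Bergman_circle_average\<close>). Since the variable \<open>s = r\<^sup>2\<close> is uniformly distributed on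
  \<open>{0..1}\<close> under area, with total mass \<open>\<pi>\<close>, and this derivative is the derivative of \<open>s g (z s)\<close> with
  respect to \<open>s\<close>, the integral is \<open>g z\<close>.

  Membership in the Bergman space gives square integrability on one slice only, whereas the reproducing property
  concerns all of them. The gap is closed by the representation formula (\<open>representation_formula\<close>): its two
  sides are holomorphic on the slice of \<open>J\<close> and agree on the real axis, hence everywhere, and the
  formula bounds the function on one slice by its values on another
  (\<open>slice_restriction_integrable\<close>).
\<close>

section \<open>Rotation invariance of area\<close>

definition to_complex :: "real \<times> real \<Rightarrow> complex" where
  "to_complex p = Complex (fst p) (snd p)"

lemma Re_to_complex [simp]: "Re (to_complex p) = fst p"
  and Im_to_complex [simp]: "Im (to_complex p) = snd p"
  by (simp_all add: to_complex_def)

lemma norm_to_complex [simp]: "norm (to_complex p) = norm p"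
  by (cases p) (simp add: to_complex_def cmod_def norm_prod_def)

lemma continuous_to_complex [continuous_intros]: "continuous_on S to_complex"
  unfolding to_complex_def Complex_eq by (intro continuous_intros)

lemma measurable_to_complex [measurable]: "to_complex \<in> borel_measurable borel"
  by (intro borel_measurable_continuous_onI continuous_to_complex)

text \<open>On each vertical line the map is \<open>y \<mapsto> a x + c y\<close> with \<open>\<bar>c\<bar> = 1\<close>, so Fubini reduces the claim to the
  translation and reflection invariance of length. The case \<open>c = - 1\<close>, \<open>a = 0\<close> is complex
  conjugation.\<close>
lemma distr_lborel_vertical_shear:
  fixes a c :: real
  assumes "\<bar>c\<bar> = 1"
  shows "distr lborel borel (\<lambda>p. (fst p, a * fst p + c * snd p)) = (lborel :: (real \<times> real) measure)"
proof (rule measure_eqI)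
  fix A :: "(real \<times> real) set"
  assume "A \<in> sets (distr lborel borel (\<lambda>p. (fst p, a * fst p + c * snd p)))"
  then have A [measurable]: "A \<in> sets borel" by simp
  have T [measurable]: "(\<lambda>p :: real \<times> real. (fst p, a * fst p + c * snd p)) \<in> borel_measurable borel"
    by (intro borel_measurable_continuous_onI continuous_intros)
  have "emeasure (distr lborel borel (\<lambda>p. (fst p, a * fst p + c * snd p))) A
      = (\<integral>\<^sup>+p. indicator A (fst p, a * fst p + c * snd p) \<partial>lborel)"
    by (subst nn_integral_indicator [symmetric], simp, subst nn_integral_distr) simp_all
  also have "\<dots> = (\<integral>\<^sup>+p. indicator A (fst p, a * fst p + c * snd p) \<partial>(lborel \<Otimes>\<^sub>M lborel))"
    by (simp add: lborel_prod)
  also have "\<dots> = (\<integral>\<^sup>+x. \<integral>\<^sup>+y. indicator A (x, a * x + c * y) \<partial>lborel \<partial>lborel)"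
    by (subst lborel.nn_integral_fst [symmetric]) (simp_all add: lborel_prod)
  also have "\<dots> = (\<integral>\<^sup>+x. \<integral>\<^sup>+y. indicator A (x, y) \<partial>lborel \<partial>lborel)"
  proof (rule nn_integral_cong)
    fix x :: real
    show "(\<integral>\<^sup>+y. indicator A (x, a * x + c * y) \<partial>lborel) = (\<integral>\<^sup>+y. indicator A (x, y) \<partial>lborel)"
      using nn_integral_real_affine [of "\<lambda>y. indicator A (x, y)" c "a * x"] assms by auto
  qed
  also have "\<dots> = (\<integral>\<^sup>+p. indicator A p \<partial>(lborel \<Otimes>\<^sub>M lborel))"
    by (subst lborel.nn_integral_fst [symmetric]) (simp_all add: lborel_prod)
  also have "\<dots> = emeasure lborel A"
    by (simp add: lborel_prod)
  finally show "emeasure (distr lborel borel (\<lambda>p. (fst p, a * fst p + c * snd p))) A = emeasure lborel A" .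
qed simp

lemma distr_lborel_swap:
  "distr lborel borel (\<lambda>p. (snd p, fst p)) = (lborel :: (real \<times> real) measure)"
proof -
  have "distr lborel borel (\<lambda>p. (snd p, fst p))
      = distr (lborel \<Otimes>\<^sub>M lborel :: (real \<times> real) measure) (lborel \<Otimes>\<^sub>M lborel) (\<lambda>(x, y). (y, x))"
    by (rule distr_cong) (simp_all add: lborel_prod case_prod_unfold flip: borel_prod)
  also have "\<dots> = lborel"
    using lborel_pair.distr_pair_swap [symmetric] by (simp add: lborel_prod)
  finally show ?thesis .
qed

lemma distr_lborel_comp:
  fixes S T :: "real \<times> real \<Rightarrow> real \<times> real"
  assumes "distr lborel borel S = lborel" "distr lborel borel T = lborel"
    and "continuous_on UNIV S" "continuous_on UNIV T"
  shows "distr lborel borel (\<lambda>p. S (T p)) = lborel"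
  using distr_distr [of S borel borel T lborel] assms(1,2) assms(3,4)[THEN borel_measurable_continuous_onI]
  by (simp add: o_def)

lemma distr_lborel_horizontal_shear:
  "distr lborel borel (\<lambda>p. (fst p + a * snd p, snd p)) = (lborel :: (real \<times> real) measure)"
proof -
  have "distr lborel borel (\<lambda>p. (fst p, a * fst p + 1 * snd p)) = (lborel :: (real \<times> real) measure)"
    by (rule distr_lborel_vertical_shear) simp
  from distr_lborel_comp [OF distr_lborel_swap distr_lborel_comp [OF this distr_lborel_swap]]
  show ?thesis by (simp add: add.commute continuous_intros)
qed

definition plane_rotation :: "complex \<Rightarrow> real \<times> real \<Rightarrow> real \<times> real" where
  "plane_rotation c p = (Re c * fst p - Im c * snd p, Im c * fst p + Re c * snd p)"

lemma to_complex_plane_rotation [simp]: "to_complex (plane_rotation c p) = c * to_complex p"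
  by (simp add: plane_rotation_def complex_eq_iff)

lemma continuous_plane_rotation: "continuous_on S (plane_rotation c)"
  unfolding plane_rotation_def by (intro continuous_intros)

text \<open>A rotation by an angle \<open>\<theta> \<noteq> \<pi>\<close> is the product of a horizontal, a vertical and again the same horizontal
  shear, with coefficients \<open>- tan (\<theta>/2)\<close>, \<open>sin \<theta>\<close>, \<open>- tan (\<theta>/2)\<close>. The rotation by \<open>\<pi>\<close> is the square of the
  one by \<open>\<pi>/2\<close>.\<close>
lemma distr_lborel_plane_rotation:
  assumes "norm c = 1"
  shows "distr lborel borel (plane_rotation c) = lborel"
proof -
  have *: "distr lborel borel (plane_rotation c) = lborel" if "norm c = 1" "Re c \<noteq> - 1" for c
  proof -
    \<comment> \<open>\<open>t = tan (\<theta>/2)\<close> for \<open>c = cis \<theta>\<close>\<close>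
    define t where "t = Im c / (1 + Re c)"
    have nz: "1 + Re c \<noteq> 0" using that by linarith
    have n: "(Re c)\<^sup>2 + (Im c)\<^sup>2 = 1"
      using that(1) by (simp add: cmod_def)
    have 1: "1 - t * Im c = Re c"
      using nz n by (simp add: t_def field_simps power2_eq_square)
    have 2: "t * (1 + Re c) = Im c"
      using nz by (simp add: t_def)
    have v: "distr lborel borel (\<lambda>p. (fst p, Im c * fst p + 1 * snd p)) = (lborel :: (real \<times> real) measure)"
      by (rule distr_lborel_vertical_shear) simp
    note h = distr_lborel_horizontal_shear [of "- t"]
    have 3: "plane_rotation c p = (fst p - t * snd p - t * (Im c * (fst p - t * snd p) + snd p),
                Im c * (fst p - t * snd p) + snd p)" for p
    proof -
      have "Re c = 1 - t * Im c" using 1 by simp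
      moreover have "Im c = t * (1 + (1 - t * Im c))" using 1 2 by simp
      ultimately show ?thesis
        unfolding plane_rotation_def prod.inject fst_conv snd_conv by (intro conjI; algebra)
    qed
    from distr_lborel_comp [OF h distr_lborel_comp [OF v h]]
    show ?thesis by (simp add: 3 [abs_def] continuous_intros)
  qed
  show ?thesis
  proof (cases "Re c = - 1")
    case True
    then have "(Im c)\<^sup>2 = 0"
      using assms by (simp add: cmod_def)
    with True have "c = \<i> * \<i>" by (simp add: complex_eq_iff)
    then have "plane_rotation c = (\<lambda>p. plane_rotation \<i> (plane_rotation \<i> p))"
      by (simp add: plane_rotation_def fun_eq_iff)
    then show ?thesis
      using distr_lborel_comp [OF *[of \<i>] *[of \<i>]] by (simp add: continuous_plane_rotation)
  qed (use * assms in auto)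
qed

section \<open>Integrals over the disc by averaging over circles\<close>

lemma area_disc:
  assumes "r \<ge> 0"
  shows "emeasure lborel (ball (0 :: real \<times> real) r) = ennreal (pi * r\<^sup>2)"
    and "emeasure lborel (cball (0 :: real \<times> real) r) = ennreal (pi * r\<^sup>2)"
  using emeasure_ball [OF assms, of "0 :: real \<times> real"] emeasure_cball [OF assms, of "0 :: real \<times> real"]
  by (simp_all add: unit_ball_vol_2 power2_eq_square)

text \<open>Both measures give \<open>{x<..}\<close> the area of the ring \<open>x < \<bar>w\<bar>\<^sup>2 < 1\<close>, which for \<open>0 \<le> x < 1\<close> is \<open>\<pi> (1 - x)\<close>. Together with rotation
  invariance this takes the place of polar coordinates; in the variable \<open>s = \<bar>w\<bar>\<^sup>2\<close> there is no
  Jacobian factor.\<close>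
lemma distr_disc_norm_sq:
  "distr (density lborel (\<lambda>p. ennreal (indicator (ball 0 1) p))) borel (\<lambda>p :: real \<times> real. (norm p)\<^sup>2)
     = density lborel (\<lambda>s. ennreal (pi * indicator {0..1} s))" (is "?M = ?N")
proof (rule measure_eqI_lessThan)
  have eq: "emeasure ?M {x<..} = emeasure lborel ({p. x < (norm p)\<^sup>2} \<inter> ball (0::real \<times> real) 1)" for x
  proof -
    have [measurable]: "{p :: real \<times> real. x < (norm p)\<^sup>2} \<in> sets borel" by measurable
    have "emeasure ?M {x<..} = (\<integral>\<^sup>+p. indicator (ball 0 1) p * indicator {p. x < (norm p)\<^sup>2} p \<partial>(lborel :: (real \<times> real) measure))"
      by (subst emeasure_distr) (simp_all add: emeasure_density vimage_def ennreal_indicator borel_measurable_indicator)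
    also have "\<dots> = emeasure lborel ({p. x < (norm p)\<^sup>2} \<inter> ball (0::real \<times> real) 1)"
      by (simp add: Int_commute borel_measurable_indicator flip: indicator_inter_arith)
    finally show ?thesis .
  qed
  show "emeasure ?M {x<..} < \<infinity>" for x
  proof -
    have "emeasure ?M {x<..} \<le> emeasure lborel (ball (0::real \<times> real) 1)"
      unfolding eq by (rule emeasure_mono) auto
    also have "\<dots> < \<infinity>" by (simp add: area_disc)
    finally show ?thesis .
  qed
  show "emeasure ?M {x<..} = emeasure ?N {x<..}" for x
  proof -
    have N: "emeasure ?N {x<..} = ennreal pi * emeasure lborel ({x<..} \<inter> {0..1})"
      by (simp add: emeasure_density ennreal_mult' ennreal_indicator nn_integral_cmult mult.assoc
            flip: indicator_inter_arith)
        (simp add: Int_commute)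
    consider "x < 0" | "0 \<le> x" "x < 1" | "1 \<le> x" by linarith
    then show ?thesis
    proof cases
      case 1
      then have "{p. x < (norm p)\<^sup>2} \<inter> ball (0::real \<times> real) 1 = ball 0 1" "{x<..} \<inter> {0..1} = {0..1}"
        by (auto intro: less_le_trans)
      then show ?thesis by (simp add: eq N area_disc)
    next
      case 2
      then have sub: "cball (0 :: real \<times> real) (sqrt x) \<subseteq> ball 0 1"
        by (simp add: cball_subset_ball_iff)
      have "x < (norm p)\<^sup>2 \<longleftrightarrow> sqrt x < norm p" for p :: "real \<times> real"
        using 2 by (metis norm_ge_zero real_less_rsqrt real_sqrt_less_iff real_sqrt_abs abs_norm_cancel)
      then have "{p. x < (norm p)\<^sup>2} \<inter> ball (0::real \<times> real) 1 = ball 0 1 - cball 0 (sqrt x)"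
        by auto
      moreover have "emeasure lborel (ball 0 1 - cball (0::real \<times> real) (sqrt x)) = ennreal pi - ennreal (pi * x)"
        using 2 sub by (subst emeasure_Diff) (auto simp: area_disc)
      moreover have "{x<..} \<inter> {0..1} = {x<..1}" using 2 by auto
      moreover have "ennreal pi - ennreal (pi * x) = ennreal (pi * (1 - x))"
        using 2 by (subst ennreal_minus) (simp_all add: algebra_simps)
      ultimately show ?thesis
        using 2 by (simp only: eq N) (simp add: ennreal_mult')
    next
      case 3
      then have "{p. x < (norm p)\<^sup>2} \<inter> ball (0::real \<times> real) 1 = {}" "{x<..} \<inter> {0..1} = {}"
        using power_le_one[of "norm _ :: real" 2] by (auto simp: not_less) (smt (verit) norm_ge_zero power_le_one)
      then show ?thesis by (simp add: eq N)
    qed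
  qed
qed simp_all

lemma integral_lborel_plane_rotation:
  fixes F :: "real \<times> real \<Rightarrow> 'a :: {banach, second_countable_topology}"
  assumes "norm c = 1" "F \<in> borel_measurable borel"
  shows "(\<integral>p. F (plane_rotation c p) \<partial>lborel) = (\<integral>p. F p \<partial>lborel)"
    and "integrable lborel (\<lambda>p. F (plane_rotation c p)) \<longleftrightarrow> integrable lborel F"
proof -
  have T: "plane_rotation c \<in> borel_measurable lborel"
    using borel_measurable_continuous_onI [OF continuous_plane_rotation] by simp
  show "(\<integral>p. F (plane_rotation c p) \<partial>lborel) = (\<integral>p. F p \<partial>lborel)"
    using integral_distr [OF T assms(2)] distr_lborel_plane_rotation [OF assms(1)] by simp
  show "integrable lborel (\<lambda>p. F (plane_rotation c p)) \<longleftrightarrow> integrable lborel F"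
    using integrable_distr_eq [OF T assms(2)] distr_lborel_plane_rotation [OF assms(1)] by simp
qed

text \<open>Each rotation preserves the integral of \<open>F\<close>, so averaging over all rotations does too, and Fubini moves
  the average inside.\<close>
lemma integral_eq_integral_circle_average:
  fixes F :: "complex \<Rightarrow> 'a :: {banach, second_countable_topology}"
  assumes int: "integrable lborel (\<lambda>p. F (to_complex p))"
    and [measurable]: "F \<in> borel_measurable borel"
  shows "(\<integral>p. F (to_complex p) \<partial>lborel)
       = (\<integral>p. (LINT t:{0..1}|lborel. F (cis (2 * pi * t) * to_complex p)) \<partial>lborel)"
proof -
  define H where "H t p = indicator {0..1} t *\<^sub>R F (cis (2 * pi * t) * to_complex p)" for t :: real and p
  have rot: "(\<integral>p. G (cis s * to_complex p) \<partial>lborel) = (\<integral>p. G (to_complex p) \<partial>lborel)"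
      "integrable lborel (\<lambda>p. G (cis s * to_complex p)) \<longleftrightarrow> integrable lborel (\<lambda>p. G (to_complex p))"
    if [measurable]: "G \<in> borel_measurable borel"
    for s and G :: "complex \<Rightarrow> 'b :: {banach, second_countable_topology}"
    using integral_lborel_plane_rotation [of "cis s" "\<lambda>p. G (to_complex p)"] by simp_all
  have "(\<lambda>q :: real \<times> real \<times> real. cis (2 * pi * fst q) * to_complex (snd q)) \<in> borel_measurable borel"
    unfolding cis_conv_exp to_complex_def Complex_eq
    by (intro borel_measurable_continuous_onI continuous_intros)
  moreover have "(\<lambda>q :: real \<times> real \<times> real. indicator {0..1} (fst q) :: real) \<in> borel_measurable (borel \<Otimes>\<^sub>M borel)"
    by measurable
  ultimately have "case_prod H \<in> borel_measurable borel"
    unfolding H_def case_prod_unfold borel_prod by measurable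
  then have meas: "case_prod H \<in> borel_measurable (lborel \<Otimes>\<^sub>M lborel)"
    by (simp add: lborel_prod)
  have "integrable (lborel \<Otimes>\<^sub>M lborel) (case_prod H)"
  proof (rule lborel_pair.Fubini_integrable [OF meas])
    have "(\<integral>p. norm (H t p) \<partial>lborel) = indicator {0..1} t *\<^sub>R (\<integral>p. norm (F (to_complex p)) \<partial>lborel)" for t
      using rot(1) [of "\<lambda>w. norm (F w)" "2 * pi * t"] by (simp add: H_def)
    then show "integrable lborel (\<lambda>t. \<integral>p. norm (case (t, p) of (t, p) \<Rightarrow> H t p) \<partial>lborel)"
      by (simp add: integrable_real_indicator)
    show "AE t in lborel. integrable lborel (\<lambda>p. case (t, p) of (t, p) \<Rightarrow> H t p)"
      using rot(2) [of F] int by (simp add: H_def)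
  qed
  from lborel_pair.Fubini_integral [OF this]
  have "(\<integral>p. (\<integral>t. H t p \<partial>lborel) \<partial>lborel) = (\<integral>t. (\<integral>p. H t p \<partial>lborel) \<partial>lborel)" .
  also have "\<dots> = (\<integral>t. indicator {0..1 :: real} t *\<^sub>R (\<integral>p. F (to_complex p) \<partial>lborel) \<partial>lborel)"
    using rot(1) [of F] by (simp add: H_def)
  also have "\<dots> = (\<integral>p. F (to_complex p) \<partial>lborel)"
    by simp
  finally show ?thesis
    by (simp add: H_def set_lebesgue_integral_def)
qed

lemma integral_disc_radial:
  fixes A :: "real \<Rightarrow> 'a :: {banach, second_countable_topology}"
  assumes "continuous_on {0..1} A"
  shows "(LINT p:ball (0 :: real \<times> real) 1|lborel. A ((norm p)\<^sup>2)) = pi *\<^sub>R (LINT s:{0..1}|lborel. A s)"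
proof -
  let ?A = "\<lambda>s. indicator {0..1} s *\<^sub>R A s"
  have [measurable]: "?A \<in> borel_measurable borel"
    by (rule borel_measurable_continuous_on_indicator) (use assms in auto)
  have [measurable]: "(\<lambda>p :: real \<times> real. (norm p)\<^sup>2) \<in> borel_measurable borel"
    by measurable
  have "(LINT p:ball (0 :: real \<times> real) 1|lborel. A ((norm p)\<^sup>2))
      = (\<integral>p. indicator (ball 0 1) p *\<^sub>R ?A ((norm (p :: real \<times> real))\<^sup>2) \<partial>lborel)"
    unfolding set_lebesgue_integral_def
    by (intro Bochner_Integration.integral_cong) (auto simp: indicator_def abs_square_le_1)
  also have "\<dots> = (\<integral>p. ?A ((norm p)\<^sup>2) \<partial>density lborel (\<lambda>p. ennreal (indicator (ball (0 :: real \<times> real) 1) p)))"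
    by (subst integral_density) (auto intro: borel_measurable_indicator)
  also have "\<dots> = (\<integral>s. ?A s \<partial>distr (density lborel (\<lambda>p. ennreal (indicator (ball (0 :: real \<times> real) 1) p)))
                      borel (\<lambda>p. (norm p)\<^sup>2))"
    by (subst integral_distr) auto
  also have "\<dots> = (\<integral>s. (pi * indicator {0..1} s) *\<^sub>R ?A s \<partial>lborel)"
    unfolding distr_disc_norm_sq by (subst integral_density) auto
  also have "\<dots> = (\<integral>s. pi *\<^sub>R ?A s \<partial>lborel)"
    by (intro Bochner_Integration.integral_cong) (auto simp: indicator_def)
  also have "\<dots> = pi *\<^sub>R (LINT s:{0..1}|lborel. A s)"
    unfolding set_lebesgue_integral_def by (rule integral_scaleR_right)
  finally show ?thesis .
qed

section \<open>The Bergman kernel of the disc for integrable holomorphic functions\<close>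

text \<open>On the circle \<open>\<bar>u\<bar> = r\<close> one has \<open>cnj u = r\<^sup>2 / u\<close>, so \<open>1 - z cnj u = (u - z r\<^sup>2) / u\<close> and the integrand
  \<open>g u / (1 - z cnj u)\<^sup>2\<close> with respect to angle is \<open>u g u / (u - z r\<^sup>2)\<^sup>2\<close> with respect to \<open>du\<close>, up to the
  factor \<open>2 \<pi> \<i>\<close>. Cauchy's formula for the derivative of \<open>u g u\<close> at \<open>z r\<^sup>2\<close> gives the value.\<close>
lemma Bergman_circle_average:
  assumes g: "g holomorphic_on ball 0 1" and z: "norm z < 1" and w: "norm w < 1"
  shows "((\<lambda>t. g (cis (2 * pi * t) * w) / (1 - z * cnj (cis (2 * pi * t) * w))\<^sup>2) has_integral
            deriv (\<lambda>u. u * g u) (z * of_real ((norm w)\<^sup>2))) {0..1}"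
proof (cases "w = 0")
  case True
  have "((\<lambda>u. u * g u) has_field_derivative 1 * g 0 + deriv g 0 * 0) (at 0)"
    by (intro DERIV_mult DERIV_ident holomorphic_derivI [OF g]) auto
  then have "deriv (\<lambda>u. u * g u) 0 = g 0"
    by (simp add: DERIV_imp_deriv)
  then show ?thesis
    using True has_integral_const_real [of "g 0" 0 1] by simp
next
  case False
  \<comment> \<open>The standard circle path starts at \<open>r\<close> and the circle here at \<open>w = r c\<close>; the argument of \<open>g\<close> is
    rotated by \<open>c\<close> to make up for this.\<close>
  define r c p where "r = norm w" and "c = sgn w" and "p = z * cnj c * of_real (r\<^sup>2)"
  have r: "0 < r" "r < 1" using False w by (auto simp: r_def)
  have c: "norm c = 1" and w_eq: "w = of_real r * c"
    using False by (simp_all add: c_def r_def norm_sgn) (simp add: sgn_div_norm scaleR_conv_of_real)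
  have cc: "c * cnj c = 1"
    using c complex_norm_square [of c] by simp
  define K f where "K = (\<lambda>u. u * g u)" and "f = (\<lambda>u. u * g (c * u))"
  have K: "K holomorphic_on ball 0 1"
    unfolding K_def by (intro holomorphic_intros g)
  have f_eq: "f = (\<lambda>u. cnj c * K (c * u))"
    using cc by (auto simp: f_def K_def fun_eq_iff algebra_simps)
  have "(\<lambda>u. K (c * u)) holomorphic_on ball 0 1"
    using holomorphic_on_compose_gen [OF _ K, of "\<lambda>u. c * u" "ball 0 1"] c
    by (simp add: o_def image_subset_iff norm_mult holomorphic_intros)
  then have f: "f holomorphic_on ball 0 1"
    unfolding f_eq by (intro holomorphic_intros)
  have "norm p = (norm z * r) * r"
    using c r by (simp add: p_def norm_mult power2_eq_square)
  also have "\<dots> < 1 * r"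
    using r mult_strict_mono' [of "norm z" 1 r 1] z by (intro mult_strict_right_mono) simp_all
  finally have p: "p \<in> ball 0 r" by simp
  have cp: "c * p = z * of_real ((norm w)\<^sup>2)"
    using cc by (simp add: p_def r_def algebra_simps)
  let ?I = "contour_integral (circlepath 0 r) (\<lambda>u. f u / (u - p)\<^sup>2)"
  have cauchy: "(\<lambda>u. f u / (u - p)\<^sup>2) contour_integrable_on circlepath 0 r"
      "(f has_field_derivative (1 / (2 * of_real pi * \<i>) * ?I)) (at p)"
    by (rule Cauchy_derivative_integral_circlepath; use p r f in
        \<open>auto intro!: holomorphic_on_imp_continuous_on intro: holomorphic_on_subset\<close>)+
  have "(f has_field_derivative cnj c * (deriv K (c * p) * c)) (at p)"
    unfolding f_eq using p r c
    by (intro DERIV_cmult DERIV_chain2 [of K] holomorphic_derivI [OF K])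
      (auto intro!: derivative_eq_intros simp: norm_mult)
  from DERIV_unique [OF cauchy(2) this]
  have I: "1 / (2 * of_real pi * \<i>) * ?I = deriv K (z * of_real ((norm w)\<^sup>2))"
    using cc by (simp add: cp mult_ac)
  have "((\<lambda>t. f (circlepath 0 r t) / (circlepath 0 r t - p)\<^sup>2 * vector_derivative (circlepath 0 r) (at t))
           has_integral ?I) {0..1}"
    using has_contour_integral_integral [OF cauchy(1)] by (simp add: has_contour_integral)
  from has_integral_mult_right [OF this, of "1 / (2 * of_real pi * \<i>)"]
  have *: "((\<lambda>t. 1 / (2 * of_real pi * \<i>) * (f (circlepath 0 r t) / (circlepath 0 r t - p)\<^sup>2 *
             vector_derivative (circlepath 0 r) (at t))) has_integral
           deriv K (z * of_real ((norm w)\<^sup>2))) {0..1}"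
    by (simp only: I)
  show ?thesis
    unfolding K_def [symmetric]
  proof (rule has_integral_eq [OF _ *])
    fix t :: real
    define e where "e = cis (2 * pi * t)"
    have e: "e * cnj e = 1" "e \<noteq> 0"
      by (simp_all add: e_def cis_cnj flip: cis_inverse)
    have cp: "circlepath 0 r t = of_real r * e"
      by (simp add: circlepath e_def cis_conv_exp mult_ac)
    have vd: "vector_derivative (circlepath 0 r) (at t) = 2 * of_real pi * \<i> * (of_real r * e)"
      by (simp add: vector_derivative_circlepath e_def cis_conv_exp mult_ac)
    have "of_real r * e * (1 - z * cnj (e * w)) = of_real r * e - z * cnj c * (of_real r)\<^sup>2 * (e * cnj e)"
      by (simp add: w_eq algebra_simps power2_eq_square)
    also have "\<dots> = of_real r * e - p"
      by (simp add: e p_def algebra_simps)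
    finally have "of_real r * e - p = of_real r * e * (1 - z * cnj (e * w))" ..
    then show "1 / (2 * of_real pi * \<i>) * (f (circlepath 0 r t) / (circlepath 0 r t - p)\<^sup>2 *
             vector_derivative (circlepath 0 r) (at t)) =
           g (cis (2 * pi * t) * w) / (1 - z * cnj (cis (2 * pi * t) * w))\<^sup>2"
      using r e unfolding cp vd e_def [symmetric]
      by (simp add: f_def w_eq power_mult_distrib power2_eq_square mult_ac)
  qed
qed

text \<open>By the chain rule the integrand is the derivative of \<open>s g (z s)\<close> with respect to \<open>s\<close>.\<close>
lemma integral_deriv_along_radius:
  assumes g: "g holomorphic_on ball 0 1" and z: "norm z < 1"
  shows "continuous_on {0..1} (\<lambda>s. deriv (\<lambda>u. u * g u) (z * of_real s))"
    and "(LINT s:{0..1}|lborel. deriv (\<lambda>u. u * g u) (z * of_real s)) = g z"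
proof -
  have K: "(\<lambda>u. u * g u) holomorphic_on ball 0 1"
    by (intro holomorphic_intros g)
  have in_ball: "norm (z * of_real s) < 1" if "s \<in> {0..1}" for s
    using that z mult_left_le [of "\<bar>s\<bar>" "norm z"] by (auto simp: norm_mult)
  show cont: "continuous_on {0..1} (\<lambda>s. deriv (\<lambda>u. u * g u) (z * of_real s))"
    by (rule continuous_on_compose2 [OF holomorphic_on_imp_continuous_on [OF holomorphic_deriv [OF K]]])
      (use in_ball in \<open>auto intro!: continuous_intros\<close>)
  have "((\<lambda>s. deriv (\<lambda>u. u * g u) (z * of_real s)) has_integral
          of_real 1 * g (z * of_real 1) - of_real 0 * g (z * of_real 0)) {0..1}"
  proof (rule fundamental_theorem_of_calculus)
    fix s :: real assume s: "s \<in> {0..1}"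
    let ?d = "deriv g (z * of_real s)"
    have D: "(g has_field_derivative ?d) (at (z * of_real s))"
      by (rule holomorphic_derivI [OF g]) (use in_ball [OF s] in auto)
    have "((\<lambda>u. u * g u) has_field_derivative 1 * g (z * of_real s) + ?d * (z * of_real s)) (at (z * of_real s))"
      by (intro DERIV_mult DERIV_ident D)
    then have eq: "deriv (\<lambda>u. u * g u) (z * of_real s) = g (z * of_real s) + ?d * (z * of_real s)"
      by (simp add: DERIV_imp_deriv)
    have "((\<lambda>x. g (z * x)) has_field_derivative ?d * z) (at (of_real s))"
      by (rule DERIV_chain2 [of g]) (use D in \<open>auto intro!: derivative_eq_intros\<close>)
    then have "((\<lambda>x. x * g (z * x)) has_field_derivative 1 * g (z * of_real s) + (?d * z) * of_real s) (at (of_real s))"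
      by (intro DERIV_mult DERIV_ident)
    then have "((\<lambda>x. x * g (z * x)) has_field_derivative deriv (\<lambda>u. u * g u) (z * of_real s)) (at (of_real s))"
      by (simp add: eq mult_ac)
    from has_vector_derivative_real_field [OF this]
    show "((\<lambda>s. of_real s * g (z * of_real s)) has_vector_derivative deriv (\<lambda>u. u * g u) (z * of_real s))
             (at s within {0..1})" .
  qed simp
  then show "(LINT s:{0..1}|lborel. deriv (\<lambda>u. u * g u) (z * of_real s)) = g z"
    using set_borel_integral_eq_integral(2) [OF borel_integrable_atLeastAtMost' [OF cont]]
    by (simp add: integral_unique)
qed

text \<open>The average of the integrand over the circle through \<open>w\<close> is the derivative of \<open>u g u\<close> at \<open>z \<bar>w\<bar>\<^sup>2\<close>, which is a
  continuous function of \<open>s = \<bar>w\<bar>\<^sup>2 \<in> {0..1}\<close>. Its integral over the disc is \<open>\<pi>\<close> times its integral over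
  \<open>s\<close>, and that is \<open>g z\<close>. Averaging needs only that the integrand is absolutely integrable, and the
  kernel is bounded for fixed \<open>z\<close>; this is why \<open>L\<^sup>1\<close> is enough.\<close>
theorem disc_Bergman_kernel_reproducing:
  assumes g: "g holomorphic_on ball 0 1"
    and int: "set_integrable lborel (ball 0 1) (\<lambda>p. g (to_complex p))" and z: "norm z < 1"
  defines "k \<equiv> \<lambda>w. 1 / (of_real pi * (1 - z * cnj w)\<^sup>2)"
  shows "set_integrable lborel (ball 0 1) (\<lambda>p. k (to_complex p) * g (to_complex p))"
    and "(LINT p:ball 0 1|lborel. k (to_complex p) * g (to_complex p)) = g z"
proof -
  define F where "F w = indicator (ball 0 1) w *\<^sub>R (g w / (1 - z * cnj w)\<^sup>2)" for w
  have lower: "1 - norm z \<le> norm (1 - z * cnj w)" if "norm w < 1" for w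
  proof -
    have "norm (z * cnj w) \<le> norm z"
      using that by (simp add: norm_mult mult_left_le)
    then show ?thesis
      using norm_triangle_ineq2 [of 1 "z * cnj w"] by simp
  qed
  then have nz: "1 - z * cnj w \<noteq> 0" if "norm w < 1" for w
    using z that by fastforce
  have "continuous_on (ball 0 1) (\<lambda>w. g w / (1 - z * cnj w)\<^sup>2)"
    using nz by (intro continuous_intros holomorphic_on_imp_continuous_on [OF g]) auto
  then have F [measurable]: "F \<in> borel_measurable borel"
    unfolding F_def by (intro borel_measurable_continuous_on_indicator) auto
  have intF: "integrable lborel (\<lambda>p. F (to_complex p))"
  proof (rule Bochner_Integration.integrable_bound)
    show "integrable lborel (\<lambda>p. (1 / (1 - norm z)\<^sup>2) * norm (indicator (ball 0 1) p *\<^sub>R g (to_complex p)))"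
      using int unfolding set_integrable_def by (intro integrable_mult_right integrable_norm)
    have "norm (F (to_complex p)) \<le> (1 / (1 - norm z)\<^sup>2) * norm (indicator (ball 0 1) p *\<^sub>R g (to_complex p))" for p
    proof (cases "norm p < 1")
      case True
      have "(1 - norm z)\<^sup>2 \<le> (norm (1 - z * cnj (to_complex p)))\<^sup>2"
        using lower [of "to_complex p"] True z by (intro power_mono) auto
      then show ?thesis
        using True z nz [of "to_complex p"]
        by (auto simp: F_def norm_divide norm_power intro!: divide_left_mono mult_pos_pos)
    qed (simp add: F_def)
    then show "AE p in lborel. norm (F (to_complex p))
        \<le> norm ((1 / (1 - norm z)\<^sup>2) * norm (indicator (ball 0 1) p *\<^sub>R g (to_complex p)))"
      by (intro AE_I2) (smt (verit) real_norm_def)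
  qed measurable
  have k_eq: "indicator (ball 0 1) p *\<^sub>R (k (to_complex p) * g (to_complex p)) = (1 / pi) *\<^sub>R F (to_complex p)" for p
    by (simp add: F_def k_def indicator_def scaleR_conv_of_real)
  show "set_integrable lborel (ball 0 1) (\<lambda>p. k (to_complex p) * g (to_complex p))"
    unfolding set_integrable_def k_eq by (intro integrable_scaleR_right intF)
  have avg: "(LINT t:{0..1}|lborel. F (cis (2 * pi * t) * to_complex p)) =
      indicator (ball 0 1) p *\<^sub>R deriv (\<lambda>u. u * g u) (z * of_real ((norm p)\<^sup>2))" for p
  proof (cases "norm p < 1")
    case True
    let ?h = "\<lambda>t. g (cis (2 * pi * t) * to_complex p) / (1 - z * cnj (cis (2 * pi * t) * to_complex p))\<^sup>2"
    have nz': "1 - z * cnj (cis (2 * pi * t) * to_complex p) \<noteq> 0" for t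
      using True by (intro nz) (simp add: norm_mult)
    have "continuous_on {0..1} ?h"
      using True nz'
      by (intro continuous_intros continuous_on_compose2 [OF holomorphic_on_imp_continuous_on [OF g]])
        (auto simp: norm_mult cis_conv_exp intro!: continuous_intros)
    then have "(LINT t:{0..1}|lborel. ?h t) = integral {0..1} ?h"
      by (intro set_borel_integral_eq_integral borel_integrable_atLeastAtMost')
    also have "\<dots> = deriv (\<lambda>u. u * g u) (z * of_real ((norm p)\<^sup>2))"
      using Bergman_circle_average [OF g z, of "to_complex p"] True by (simp add: integral_unique)
    finally show ?thesis
      using True by (simp add: F_def norm_mult)
  qed (simp add: F_def norm_mult)
  have "(\<integral>p. F (to_complex p) \<partial>lborel) = pi *\<^sub>R g z"
    unfolding integral_eq_integral_circle_average [OF intF F] avg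
    using integral_disc_radial [OF integral_deriv_along_radius(1) [OF g z]]
    by (simp add: set_lebesgue_integral_def [symmetric] integral_deriv_along_radius(2) [OF g z])
  then show "(LINT p:ball 0 1|lborel. k (to_complex p) * g (to_complex p)) = g z"
    unfolding set_lebesgue_integral_def k_eq by simp
qed

section \<open>Slices as copies of the complex numbers\<close>

lemma octonion_mult_simps:
  fixes x y z :: octonion
  shows "x * (y + z) = x * y + x * z" "(x + y) * z = x * z + y * z"
    "x * (y - z) = x * y - x * z" "(x - y) * z = x * z - y * z"
    "x * - y = - (x * y)" "- x * y = - (x * y)"
    "r *\<^sub>R x * y = r *\<^sub>R (x * y)" "x * r *\<^sub>R y = r *\<^sub>R (x * y)"
    "1 * x = x" "x * 1 = x" "0 * x = 0" "x * 0 = 0"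
  by (simp_all add: octonion_eq_iff algebra_simps)

lemma bounded_linear_octonion_mult: "bounded_linear (\<lambda>y. x * y :: octonion)"
  by (rule bounded_linear_intro [where K = "norm x"])
    (simp_all add: octonion_mult_simps octonion_norm_mult mult.commute)

lemma bounded_linear_octo_cnj: "bounded_linear octo_cnj"
  by (rule linear_conv_bounded_linear [THEN iffD1], rule linearI) (simp_all add: octonion_eq_iff)

lemma octonion_power2: "(x :: octonion)\<^sup>2 = x * x"
  by (simp add: numeral_2_eq_2 octonion_mult_simps)

definition slice_of :: "octonion \<Rightarrow> complex \<Rightarrow> octonion" where
  "slice_of I z = Re z *\<^sub>R 1 + Im z *\<^sub>R I"

lemma slice_point_eq: "slice_point I p = slice_of I (to_complex p)"
  by (simp add: slice_of_def slice_point_def case_prod_unfold)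

lemma bounded_linear_slice_of: "bounded_linear (slice_of I)"
  unfolding slice_of_def
  by (intro bounded_linear_add bounded_linear_scaleR_const bounded_linear_Re bounded_linear_Im)

lemma imag_unit_mult:
  assumes "I \<in> imag_sphere"
  shows "I * (I * x) = - x" "I * I = - 1" "octo_cnj I = - I"
proof -
  have I: "Ree I = 0" "norm I = 1"
    using assms by (auto simp: imag_sphere_def)
  show c: "octo_cnj I = - I"
    using I by (simp add: octonion_eq_iff)
  have "- (I * (I * y)) = y" for y
    using octonion_cnj_mult_mult [of I y] I(2) by (simp add: c octonion_mult_simps)
  then show *: "I * (I * y) = - y" for y
    by (metis minus_minus)
  show "I * I = - 1"
    using * [of 1] by (simp add: octonion_mult_simps)
qed

context
  fixes I :: octonion
  assumes I: "I \<in> imag_sphere"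
begin

text \<open>The associative law when the two left factors lie in the same slice. It makes the octonions
  a complex vector space under left multiplication by the slice.\<close>
lemma slice_of_mult_left: "slice_of I z * (slice_of I w * a) = slice_of I (z * w) * a"
  by (simp add: slice_of_def octonion_mult_simps imag_unit_mult [OF I] algebra_simps)

lemma slice_of_mult: "slice_of I z * slice_of I w = slice_of I (z * w)"
  using slice_of_mult_left [of z w 1] by (simp add: octonion_mult_simps)

lemma slice_of_algebra:
  "slice_of I z + slice_of I w = slice_of I (z + w)"
  "1 - slice_of I z = slice_of I (1 - z)"
  "r *\<^sub>R slice_of I z = slice_of I (of_real r * z)"
  by (simp_all add: slice_of_def algebra_simps)

lemma octo_cnj_slice_of: "octo_cnj (slice_of I z) = slice_of I (cnj z)"
  using bounded_linear_octo_cnj imag_unit_mult(3) [OF I]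
  by (simp add: slice_of_def linear_simps octonion_eq_iff)

lemma Ree_slice_of: "Ree (slice_of I z) = Re z"
  using I by (simp add: slice_of_def imag_sphere_def)

lemma norm_slice_of: "norm (slice_of I z) = norm z"
proof -
  have "(norm (slice_of I z))\<^sup>2 *\<^sub>R (1 :: octonion) = (norm z)\<^sup>2 *\<^sub>R 1"
    unfolding octonion_mult_cnj(1) [symmetric] octo_cnj_slice_of slice_of_mult
    by (simp add: slice_of_def complex_norm_square [symmetric] del: of_real_power)
  then have "(norm (slice_of I z))\<^sup>2 = (norm z)\<^sup>2"
    by (simp add: octonion_eq_iff)
  then show ?thesis by simp
qed

lemma inverse_slice_of: "inverse (slice_of I z) = slice_of I (inverse z)"
proof -
  have "of_real (inverse ((norm z)\<^sup>2)) * cnj z = inverse z"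
  proof (cases "z = 0")
    case False
    then have "of_real (inverse ((norm z)\<^sup>2)) * (z * cnj z) = 1"
      unfolding complex_norm_square [symmetric] of_real_mult [symmetric] by simp
    then have "z * (of_real (inverse ((norm z)\<^sup>2)) * cnj z) = 1"
      by (simp only: mult.left_commute)
    then show ?thesis by (rule inverse_unique [symmetric])
  qed simp
  then show ?thesis
    by (simp only: inverse_octonion_def octo_cnj_slice_of norm_slice_of slice_of_algebra)
qed

lemma slice_disc_eq: "slice_disc I = ball 0 1"
  by (auto simp: slice_disc_def slice_point_eq norm_slice_of)

text \<open>Everything in the formula of the kernel lies in one commutative slice. There the numerator is
  \<open>(1 - cnj w cnj z)\<^sup>2\<close> and the base of the inverse square is \<open>(1 - w cnj z) (1 - cnj w cnj z)\<close>, so that the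
  classical kernel of the disc remains.\<close>
lemma bergman_kernel_slice:
  assumes "norm w < 1" "norm z < 1"
  shows "bergman_kernel (slice_of I w) (slice_of I z) = slice_of I (1 / (of_real pi * (1 - w * cnj z)\<^sup>2))"
proof -
  have "norm (cnj w * cnj z) < 1" "norm (w * cnj z) < 1"
    using assms mult_strict_mono' [of "norm w" 1 "norm z" 1] by (simp_all add: norm_mult)
  then have nz: "1 - cnj w * cnj z \<noteq> 0" "1 - w * cnj z \<noteq> 0"
    by auto
  have num: "1 - of_real 2 * (cnj w * cnj z) + cnj w * cnj w * (cnj z * cnj z)
      = (1 - cnj w * cnj z) * (1 - cnj w * cnj z)"
    by (simp add: algebra_simps)
  have cancel: "of_real (1 / pi) * (b * b * (inverse (a * b) * inverse (a * b))) = 1 / (of_real pi * a\<^sup>2)"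
    if "a \<noteq> 0" "b \<noteq> 0" for a b :: complex
    using that by (simp add: field_simps power2_eq_square)
  have den: "1 - of_real (2 * Re w) * cnj z + of_real ((norm w)\<^sup>2) * (cnj z * cnj z)
      = (1 - w * cnj z) * (1 - cnj w * cnj z)"
    unfolding complex_norm_square complex_add_cnj [symmetric]
    by (simp add: algebra_simps)
  show ?thesis
    by (simp only: bergman_kernel_def octonion_power2 octo_cnj_slice_of slice_of_mult Ree_slice_of
        norm_slice_of slice_of_algebra inverse_slice_of den num cancel [OF nz(2) nz(1)])
qed

end

section \<open>Slice monogenic functions as holomorphic functions\<close>

text \<open>The complex-linear functional with real part \<open>x \<mapsto> x \<bullet> a\<close>, for the complex structure given by
  left multiplication by \<open>I\<close>. Using all of these instead of a complex basis avoids the choice of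
  a splitting of the octonions.\<close>
definition slice_functional :: "octonion \<Rightarrow> octonion \<Rightarrow> octonion \<Rightarrow> complex" where
  "slice_functional I a x = Complex (x \<bullet> a) (- ((I * x) \<bullet> a))"

lemma bounded_linear_slice_functional: "bounded_linear (slice_functional I a)"
  by (rule linear_conv_bounded_linear [THEN iffD1], rule linearI)
    (simp_all add: slice_functional_def complex_eq_iff octonion_mult_simps inner_add_left inner_diff_left inner_minus_left inner_scaleR_left)

lemma Re_slice_functional [simp]: "Re (slice_functional I a x) = x \<bullet> a"
  by (simp add: slice_functional_def)

lemma slice_functional_mult:
  assumes "I \<in> imag_sphere"
  shows "slice_functional I a (slice_of I z * x) = z * slice_functional I a x"
  by (simp add: slice_functional_def slice_of_def octonion_mult_simps imag_unit_mult [OF assms]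
      complex_eq_iff inner_add_left inner_diff_left inner_minus_left inner_scaleR_left)

lemma octonion_eq_by_slice_functional:
  assumes "\<And>a. slice_functional I a x = slice_functional I a y"
  shows "x = y"
proof -
  have "x \<bullet> a = y \<bullet> a" for a
    using assms [of a] by (metis Re_slice_functional)
  then show ?thesis using vector_eq_rdot [of x y] by blast
qed

text \<open>The derivative is complex-linear for left multiplication by the slice: this is the
  Cauchy--Riemann equation for \<open>u + v I\<close> in a form without partial derivatives.\<close>
definition left_holomorphic :: "octonion \<Rightarrow> (complex \<Rightarrow> octonion) \<Rightarrow> complex set \<Rightarrow> bool" where
  "left_holomorphic I F S \<longleftrightarrow> (\<forall>z\<in>S. \<exists>d. (F has_derivative (\<lambda>h. slice_of I h * d)) (at z))"

lemma holomorphic_slice_functional: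
  assumes I: "I \<in> imag_sphere" and F: "left_holomorphic I F S"
  shows "(\<lambda>z. slice_functional I a (F z)) holomorphic_on S"
proof (rule holomorphic_onI)
  fix z assume "z \<in> S"
  then obtain d where "(F has_derivative (\<lambda>h. slice_of I h * d)) (at z)"
    using F by (auto simp: left_holomorphic_def)
  from bounded_linear.has_derivative [OF bounded_linear_slice_functional this]
  have "((\<lambda>z. slice_functional I a (F z)) has_field_derivative slice_functional I a d) (at z)"
    unfolding has_field_derivative_def slice_functional_mult [OF I]
    by (rule has_derivative_eq_rhs) (simp add: fun_eq_iff slice_functional_mult [OF I] mult.commute)
  then show "(\<lambda>z. slice_functional I a (F z)) field_differentiable at z within S"
    using field_differentiable_at_within field_differentiable_def by blast
qed

lemma left_holomorphic_slice_restriction: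
  assumes f: "slice_monogenic f" and I: "I \<in> imag_sphere"
  shows "left_holomorphic I (\<lambda>z. f (slice_of I z)) (ball 0 1)"
  unfolding left_holomorphic_def
proof
  fix z :: complex assume z: "z \<in> ball 0 1"
  then have zI: "slice_of I z \<in> ball 0 1" by (simp add: norm_slice_of [OF I])
  then have "f differentiable at (slice_of I z)"
    using f by (auto simp: slice_monogenic_def differentiable_on_def at_within_open [OF _ open_ball])
  then obtain D where D: "(f has_derivative D) (at (slice_of I z))"
    by (auto simp: differentiable_def)
  interpret D: bounded_linear D by (rule has_derivative_bounded_linear [OF D])
  have "((\<lambda>t. slice_point I (t, Im z)) has_derivative (\<lambda>h. h *\<^sub>R 1)) (at (Re z))"
    "((\<lambda>t. slice_point I (Re z, t)) has_derivative (\<lambda>h. h *\<^sub>R I)) (at (Im z))"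
    by (auto simp: slice_point_def intro!: derivative_eq_intros)
  then have "((\<lambda>t. f (slice_point I (t, Im z))) has_derivative (\<lambda>h. D (h *\<^sub>R 1))) (at (Re z))"
    "((\<lambda>t. f (slice_point I (Re z, t))) has_derivative (\<lambda>h. D (h *\<^sub>R I))) (at (Im z))"
    using has_derivative_compose [where g = f and g' = D] D by (simp_all add: slice_of_def slice_point_def)
  then have "vector_derivative (\<lambda>t. f (slice_point I (t, Im z))) (at (Re z)) = D 1"
    "vector_derivative (\<lambda>t. f (slice_point I (Re z, t))) (at (Im z)) = D I"
    by (simp_all add: vector_derivative_at has_vector_derivative_def D.scaleR)
  moreover have "(Re z, Im z) \<in> slice_disc I"
    using z by (simp add: slice_disc_eq [OF I] norm_prod_def cmod_def)
  ultimately have CR: "D 1 + I * D I = 0"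
    using f I unfolding slice_monogenic_def by fastforce
  have "I * (D 1 + I * D I) = 0"
    by (simp add: CR octonion_mult_simps)
  then have DI: "D I = I * D 1"
    by (simp add: octonion_mult_simps imag_unit_mult [OF I])
  have "D (slice_of I h) = slice_of I h * D 1" for h
    by (simp add: slice_of_def D.add D.scaleR DI octonion_mult_simps)
  moreover have "((\<lambda>z. f (slice_of I z)) has_derivative (\<lambda>h. D (slice_of I h))) (at z)"
    by (rule has_derivative_compose [OF bounded_linear_imp_has_derivative [OF bounded_linear_slice_of] D])
  ultimately show "\<exists>d. ((\<lambda>z. f (slice_of I z)) has_derivative (\<lambda>h. slice_of I h * d)) (at z)"
    by auto
qed

text \<open>If \<open>d\<close> and \<open>d'\<close> are the complex derivatives of \<open>F\<close> at \<open>z\<close> and \<open>cnj z\<close>, then the right-hand side of the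
  representation formula has at \<open>z\<close> the complex derivative given by the same formula with
  \<open>d, d'\<close> in place of \<open>F z, F (cnj z)\<close>, now for the structure \<open>J\<close>.\<close>
lemma left_holomorphic_representation:
  assumes I: "I \<in> imag_sphere" and J: "J \<in> imag_sphere"
    and F: "left_holomorphic I F (ball 0 1)"
  shows "left_holomorphic J (\<lambda>z. (1/2) *\<^sub>R (F z + F (cnj z)) + (1/2) *\<^sub>R (J * (I * (F (cnj z) - F z)))) (ball 0 1)"
  unfolding left_holomorphic_def
proof
  fix z :: complex assume z: "z \<in> ball 0 1"
  then have "cnj z \<in> ball 0 1" by simp
  with z F obtain d d' where d: "(F has_derivative (\<lambda>h. slice_of I h * d)) (at z)"
    and d': "(F has_derivative (\<lambda>h. slice_of I h * d')) (at (cnj z))"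
    unfolding left_holomorphic_def by blast
  have d'': "((\<lambda>z. F (cnj z)) has_derivative (\<lambda>h. slice_of I (cnj h) * d')) (at z)"
    by (rule has_derivative_compose [OF bounded_linear_imp_has_derivative [OF bounded_linear_cnj] d'])
  note mult = bounded_linear.has_derivative [OF bounded_linear_octonion_mult]
  have "((\<lambda>z. (1/2) *\<^sub>R (F z + F (cnj z)) + (1/2) *\<^sub>R (J * (I * (F (cnj z) - F z)))) has_derivative
     (\<lambda>h. (1/2) *\<^sub>R (slice_of I h * d + slice_of I (cnj h) * d')
        + (1/2) *\<^sub>R (J * (I * (slice_of I (cnj h) * d' - slice_of I h * d))))) (at z)"
    by (intro has_derivative_add has_derivative_diff has_derivative_scaleR_right mult d d'')
  moreover have "(1/2) *\<^sub>R (slice_of I h * d + slice_of I (cnj h) * d')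
        + (1/2) *\<^sub>R (J * (I * (slice_of I (cnj h) * d' - slice_of I h * d)))
      = slice_of J h * ((1/2) *\<^sub>R (d + d') + (1/2) *\<^sub>R (J * (I * (d' - d))))" for h
    by (simp add: slice_of_def octonion_mult_simps imag_unit_mult [OF I] imag_unit_mult [OF J] algebra_simps)
  ultimately show "\<exists>e. ((\<lambda>z. (1/2) *\<^sub>R (F z + F (cnj z)) + (1/2) *\<^sub>R (J * (I * (F (cnj z) - F z))))
      has_derivative (\<lambda>h. slice_of J h * e)) (at z)"
    by auto
qed

text \<open>Both sides are holomorphic in \<open>z\<close> for the structure \<open>J\<close>, and they agree for real \<open>z\<close>, where all slices
  meet. Analytic continuation from the interval \<open>{0<..<1}\<close> does the rest.\<close>
lemma representation_formula:
  assumes f: "slice_monogenic f" and I: "I \<in> imag_sphere" and J: "J \<in> imag_sphere" and z: "norm z < 1"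
  shows "f (slice_of J z) = (1/2) *\<^sub>R (f (slice_of I z) + f (slice_of I (cnj z)))
           + (1/2) *\<^sub>R (J * (I * (f (slice_of I (cnj z)) - f (slice_of I z))))"
    (is "_ = ?R z")
proof (rule octonion_eq_by_slice_functional [of J])
  fix a
  let ?h = "\<lambda>z. slice_functional J a (f (slice_of J z)) - slice_functional J a (?R z)"
  have hol: "?h holomorphic_on ball 0 1"
    using left_holomorphic_slice_restriction [OF f J]
      left_holomorphic_representation [OF I J left_holomorphic_slice_restriction [OF f I]]
    by (intro holomorphic_on_diff holomorphic_slice_functional [OF J])
  have lim: "0 islimpt (of_real ` {0<..<1} :: complex set)"
    unfolding islimpt_approachable
  proof (intro allI impI)
    fix e :: real assume "e > 0"
    then obtain m where "0 < m" "m < min 1 e"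
      using dense [of 0 "min 1 e"] by auto
    then show "\<exists>x'\<in>of_real ` {0<..<1}. x' \<noteq> 0 \<and> dist x' (0 :: complex) < e"
      by (intro bexI [of _ "of_real m"]) auto
  qed
  have zero: "?h x = 0" if "x \<in> of_real ` {0<..<1}" for x
  proof -
    from that obtain t where "x = of_real t" by blast
    then have "slice_of J x = t *\<^sub>R 1" "slice_of I x = t *\<^sub>R 1" "cnj x = x"
      by (simp_all add: slice_of_def)
    then show ?thesis
      by (simp only: diff_self octonion_mult_simps scaleR_half_double scaleR_zero_right add_0_right)
  qed
  have sub: "(of_real ` {0<..<1} :: complex set) \<subseteq> ball 0 1"
    by auto
  have "?h z = 0"
    by (rule analytic_continuation [OF hol open_ball connected_ball sub _ lim zero]) (use z in simp_all)
  then show "slice_functional J a (f (slice_of J z)) = slice_functional J a (?R z)"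
    by simp
qed

section \<open>Integrability on every slice and the reproducing property\<close>

text \<open>Square integrability is given on a single slice \<open>I\<close>. The representation formula bounds
  \<open>\<bar>f\<bar>\<close> on the slice \<open>J\<close> by the sum of its values at the two conjugate points of the slice \<open>I\<close>, and
  \<open>t \<le> 1 + t\<^sup>2\<close> turns square integrability on the disc, which has finite area, into integrability.\<close>
lemma slice_restriction_integrable:
  assumes f: "f \<in> slice_bergman_space" and J: "J \<in> imag_sphere"
  shows "set_integrable lborel (ball 0 1) (\<lambda>p. f (slice_of J (to_complex p)))"
proof -
  obtain I where I: "I \<in> imag_sphere" and mono: "slice_monogenic f"
    and sq: "set_integrable lborel (slice_disc I) (\<lambda>p. (norm (f (slice_point I p)))\<^sup>2)"
    using f by (auto simp: slice_bergman_space_def)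
  let ?F = "\<lambda>p. f (slice_of I (to_complex p))"
  let ?N = "\<lambda>p. indicator (ball 0 1) p *\<^sub>R (norm (?F p))\<^sup>2"
  let ?refl = "\<lambda>p :: real \<times> real. (fst p, 0 * fst p + - 1 * snd p)"
  have N: "integrable lborel ?N"
    using sq by (simp add: set_integrable_def slice_disc_eq [OF I] slice_point_eq)
  have refl: "?refl \<in> borel_measurable lborel"
    by (simp add: borel_measurable_continuous_onI continuous_intros)
  have "integrable (distr lborel borel ?refl) ?N"
    using N distr_lborel_vertical_shear [of "- 1" 0] by simp
  then have N': "integrable lborel (\<lambda>p. ?N (?refl p))"
    by (rule integrable_distr [OF refl])
  have one: "integrable lborel (\<lambda>p. indicator (ball 0 1) (p :: real \<times> real) :: real)"
    by (simp add: integrable_indicator_iff area_disc)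
  have "continuous_on (ball 0 1) f"
    using mono by (intro differentiable_imp_continuous_on) (auto simp: slice_monogenic_def)
  then have cont: "continuous_on (ball 0 1) (\<lambda>p. f (slice_of J (to_complex p)))"
    by (rule continuous_on_compose2)
      (auto simp: norm_slice_of [OF J] intro!: continuous_intros bounded_linear.continuous_on [OF bounded_linear_slice_of])
  show ?thesis
    unfolding set_integrable_def
  proof (rule Bochner_Integration.integrable_bound)
    show "integrable lborel (\<lambda>p. 2 * indicator (ball 0 1) p + ?N p + ?N (?refl p))"
      using one N N' by (intro Bochner_Integration.integrable_add integrable_mult_right) auto
    show "(\<lambda>p. indicator (ball 0 1) p *\<^sub>R f (slice_of J (to_complex p))) \<in> borel_measurable lborel"
      using borel_measurable_continuous_on_indicator [OF _ cont] by simp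
    have "norm (indicator (ball 0 1) p *\<^sub>R f (slice_of J (to_complex p)))
        \<le> norm (2 * indicator (ball 0 1) p + ?N p + ?N (?refl p))" for p
    proof (cases "norm p < 1")
      case True
      let ?a = "f (slice_of I (to_complex p))" and ?b = "f (slice_of I (cnj (to_complex p)))"
      have conj: "cnj (to_complex p) = to_complex (?refl p)" "norm (?refl p) = norm p"
        by (simp_all add: complex_eq_iff norm_prod_def)
      have bd: "x \<le> 1 + x\<^sup>2" for x :: real
        using zero_le_power2 [of "x - 1 / 2"] by (simp add: power2_diff power2_eq_square field_simps)
      have unit: "norm (J * y) = norm y" "norm (I * y) = norm y" for y
        using I J by (simp_all add: octonion_norm_mult imag_sphere_def)
      have "norm (f (slice_of J (to_complex p))) \<le> (1/2) * norm (?a + ?b) + (1/2) * norm (?b - ?a)"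
        unfolding representation_formula [OF mono I J, of "to_complex p", simplified norm_to_complex, OF True]
        by (rule norm_triangle_le) (simp add: unit)
      also have "\<dots> \<le> norm ?a + norm ?b"
        using norm_triangle_ineq [of ?a ?b] norm_triangle_ineq4 [of ?b ?a] by linarith
      also have "\<dots> \<le> 2 + (norm ?a)\<^sup>2 + (norm ?b)\<^sup>2"
        using bd [of "norm ?a"] bd [of "norm ?b"] by linarith
      also have "\<dots> = 2 * indicator (ball 0 1) p + ?N p + ?N (?refl p)"
        unfolding conj using True conj(2) by (simp add: indicator_def)
      finally show ?thesis
        using True by simp
    qed simp
    then show "AE p in lborel. norm (indicator (ball 0 1) p *\<^sub>R f (slice_of J (to_complex p)))
        \<le> norm (2 * indicator (ball 0 1) p + ?N p + ?N (?refl p))"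
      by simp
  qed
qed

text \<open>Testing the octonion-valued integral against \<open>a\<close> amounts to taking the real part of the scalar integral for
  the functional of \<open>I\<close> and \<open>a\<close>: by complex linearity, that functional takes the scalar kernel
  out of the product.\<close>
theorem proposition4p19:
  shows "reproducing_kernel bergman_kernel"
  unfolding reproducing_kernel_def
proof (intro ballI)
  fix f I x
  assume f: "f \<in> slice_bergman_space" and I: "I \<in> imag_sphere" and x: "x \<in> ball 0 1 \<inter> complex_slice I"
  have mono: "slice_monogenic f"
    using f by (simp add: slice_bergman_space_def)
  obtain z where x_eq: "x = slice_of I z" and z: "norm z < 1"
    using x norm_slice_of [OF I] by (auto simp: complex_slice_def slice_point_eq)
  let ?k = "\<lambda>w. 1 / (of_real pi * (1 - z * cnj w)\<^sup>2)"
  let ?h = "\<lambda>p. indicator (ball 0 1) p *\<^sub>R slice_integrand I f (\<lambda>y. bergman_kernel y x) p"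
  let ?G = "\<lambda>a w. slice_functional I a (f (slice_of I w))"
  have h_eq: "slice_integrand I f (\<lambda>y. bergman_kernel y x) p
      = slice_of I (?k (to_complex p)) * f (slice_of I (to_complex p))" if "norm p < 1" for p
    using that z
    by (simp add: slice_integrand_def slice_point_eq x_eq bergman_kernel_slice [OF I] octo_cnj_slice_of [OF I] mult.commute)
  have inner_h: "?h p \<bullet> a = Re (indicator (ball 0 1) p *\<^sub>R (?k (to_complex p) * ?G a (to_complex p)))" for a p
  proof (cases "norm p < 1")
    case True
    then show ?thesis
      by (simp add: h_eq flip: slice_functional_mult [OF I])
  qed simp
  have hol: "?G a holomorphic_on ball 0 1" for a
    by (rule holomorphic_slice_functional [OF I left_holomorphic_slice_restriction [OF mono I]])
  have "set_integrable lborel (ball 0 1) (\<lambda>p. ?G a (to_complex p))" for a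
    using integrable_bounded_linear [OF bounded_linear_slice_functional
        slice_restriction_integrable [OF f I, unfolded set_integrable_def]]
    by (simp add: set_integrable_def linear_simps [OF bounded_linear_slice_functional])
  note disc = disc_Bergman_kernel_reproducing [OF hol this z]
  have int_inner: "integrable lborel (\<lambda>p. ?h p \<bullet> a)" for a
    unfolding inner_h using disc(1) [of a] by (intro integrable_Re) (simp add: set_integrable_def)
  have "integrable lborel (\<lambda>p. \<Sum>b\<in>Basis. (?h p \<bullet> b) *\<^sub>R b)"
    by (intro Bochner_Integration.integrable_sum integrable_scaleR_left int_inner)
  then have int: "integrable lborel ?h"
    by (simp only: euclidean_representation)
  have "(\<integral>p. ?h p \<partial>lborel) \<bullet> a = f x \<bullet> a" for a
  proof -
    have "(\<integral>p. ?h p \<partial>lborel) \<bullet> a = (\<integral>p. ?h p \<bullet> a \<partial>lborel)"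
      by (rule integral_inner_left [symmetric]) (rule int)
    also have "\<dots> = Re (\<integral>p. indicator (ball 0 1) p *\<^sub>R (?k (to_complex p) * ?G a (to_complex p)) \<partial>lborel)"
      unfolding inner_h using disc(1) [of a] by (intro integral_Re) (simp add: set_integrable_def)
    also have "\<dots> = Re (?G a z)"
      using disc(2) [of a] by (simp only: set_lebesgue_integral_def)
    finally show ?thesis by (simp add: x_eq)
  qed
  then have "(\<integral>p. ?h p \<partial>lborel) = f x"
    using vector_eq_rdot [of "\<integral>p. ?h p \<partial>lborel" "f x"] by blast
  then show "set_integrable lborel (slice_disc I) (slice_integrand I f (\<lambda>y. bergman_kernel y x)) \<and>
      slice_inner I f (\<lambda>y. bergman_kernel y x) = f x"
    using int by (simp add: slice_inner_def set_integrable_def set_lebesgue_integral_def slice_disc_eq [OF I])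
qed

end
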